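(* Let $\Omega\subset\mathbb{R}^2$ be an open, simply connected domain, let $m\ge1$, let $W\in C^1(\mathbb{R}^m,\mathbb{R})$, and let $u\in C^2(\Omega,\mathbb{R}^m)$ be a solution of $\Delta u=\nabla W(u)$ in $\Omega$. Then there exists a function $U\in C^3(\Omega,\mathbb{R})$, unique up to addition of an affine function, whose Hessian matrix is $$D^2U=\begin{pmatrix}|u_{x_1}|^2-|u_{x_2}|^2+2W(u) & 2\,u_{x_1}\cdot u_{x_2}\\ 2\,u_{x_1}\cdot u_{x_2} & |u_{x_2}|^2-|u_{x_1}|^2+2W(u)\end{pmatrix}\quad\text{in }\Omega.$$ In particular, $\Delta U=4W(u)$ in $\Omega$.
   Context: $u_{x_i}=\partial u/\partial x_i\in\mathbb{R}^m$; $\cdot$ and $|\cdot|$ denote the Euclidean inner product and norm. A domain is connected. *)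

theory Defs
  imports "HOL-Analysis.Analysis"
begin

definition partial_deriv :: "'n \<Rightarrow> (real^'n \<Rightarrow> 'b) \<Rightarrow> real^'n \<Rightarrow> 'b::real_normed_vector"
  where "partial_deriv i f x = vector_derivative (\<lambda>t. f (x + t *\<^sub>R axis i 1)) (at 0)"

text \<open>Class \<open>C\<^sup>k\<close>, intended for open sets \<open>S\<close>. Differentiability at each point (with respect to a full
  neighbourhood) makes the partial derivatives of orders below \<open>k\<close> genuine ones; it is
  implied by the continuity of all partial derivatives up to order \<open>k\<close>, so this is the usual class.
  Only the values of \<open>f\<close> on \<open>S\<close> matter.\<close>

primrec C_k_on :: "nat \<Rightarrow> (real^'n \<Rightarrow> 'b::real_normed_vector) \<Rightarrow> (real^'n) set \<Rightarrow> bool"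
  where
    "C_k_on 0 f S \<longleftrightarrow> continuous_on S f"
  | "C_k_on (Suc k) f S \<longleftrightarrow>
       (\<forall>x\<in>S. f differentiable (at x)) \<and> (\<forall>i. C_k_on k (partial_deriv i f) S)"

definition laplacian :: "(real^'n \<Rightarrow> 'b) \<Rightarrow> real^'n \<Rightarrow> 'b::real_normed_vector"
  where "laplacian f x = (\<Sum>i\<in>UNIV. partial_deriv i (partial_deriv i f) x)"

definition hessian :: "(real^'n \<Rightarrow> real) \<Rightarrow> real^'n \<Rightarrow> real^'n^'n"
  where "hessian f x = (\<chi> i j. partial_deriv j (partial_deriv i f) x)"

definition hessian_field ::
  "(real^'m \<Rightarrow> real) \<Rightarrow> (real^2 \<Rightarrow> real^'m) \<Rightarrow> real^2 \<Rightarrow> real^2^2"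
  where
    "hessian_field W u x =
       (let u1 = partial_deriv 1 u x; u2 = partial_deriv 2 u x in
        vector
          [vector [(norm u1)\<^sup>2 - (norm u2)\<^sup>2 + 2 * W (u x), 2 * (u1 \<bullet> u2)],
           vector [2 * (u1 \<bullet> u2), (norm u2)\<^sup>2 - (norm u1)\<^sup>2 + 2 * W (u x)]])"

definition hessian_potential ::
  "(real^2) set \<Rightarrow> (real^'m \<Rightarrow> real) \<Rightarrow> (real^2 \<Rightarrow> real^'m) \<Rightarrow> (real^2 \<Rightarrow> real) \<Rightarrow> bool"
  where
    "hessian_potential \<Omega> W u U \<longleftrightarrow>
       C_k_on 3 U \<Omega> \<and> (\<forall>x\<in>\<Omega>. hessian U x = hessian_field W u x)"

end

theory Submission
  imports Defs "HOL-Complex_Analysis.Riemann_Mapping" "HOL-Real_Asymp.Real_Asymp"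
begin

text \<open>By the equation \<open>\<Delta>u = \<nabla>W(u)\<close> and the symmetry of the second derivatives of \<open>u\<close>, both rows of the
  prescribed Hessian are closed \<open>C\<^sup>1\<close> vector fields, so on the simply connected set \<open>\<Omega>\<close> they are the
  gradients of functions \<open>p\<close> and \<open>q\<close>. As the matrix is symmetric, \<open>(p, q)\<close> is closed too, and its
  potential is \<open>U\<close>. The difference of two solutions has vanishing Hessian on a connected set and
  is therefore affine.\<close>

subsection \<open>Partial derivatives and the classes \<open>C\<^sup>k\<close>\<close>

text \<open>The matrix comes from the stress-energy tensor
  \<open>T_ij = u_i . u_j - delta_ij (|Du|^2/2 + W(u))\<close>, whose divergence vanishes for
  solutions: it is the cofactor matrix of \<open>-2 T\<close>. In the plane, passing to the cofactor
  matrix of a symmetric field turns divergence-free rows into curl-free rows, which is why the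
  prescribed entries can be second derivatives. Two obstacles shape the argument. The entries are
  only C^1, because they contain first derivatives of a C^2 map, so potentials must be built for C^1
  fields; the third derivative of \<open>U\<close> is gained only because the gradients are known
  explicitly at each integration. And a simply connected set need not be star-shaped, so integrating
  along rays is not directly possible. The Riemann mapping theorem supplies a disc on which it is,
  at the cost of working in the complex plane and of checking that closedness survives the conformal
  change of variables.\<close>

lemma has_vector_derivative_along_line:
  assumes "(f has_derivative D) (at (x + t *\<^sub>R e))"
  shows "((\<lambda>t. f (x + t *\<^sub>R e)) has_vector_derivative D e) (at t)"
proof -
  interpret bounded_linear D
    using assms by (rule has_derivative_bounded_linear)
  have "((\<lambda>t. f (x + t *\<^sub>R e)) has_derivative (\<lambda>s. D (s *\<^sub>R e))) (at t)"
    by (rule has_derivative_compose[of "\<lambda>t. x + t *\<^sub>R e", OF _ assms]) (auto intro!: derivative_eq_intros)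
  then show ?thesis
    by (simp add: has_vector_derivative_def scaleR)
qed

lemma partial_deriv_eqI:
  assumes "(f has_derivative D) (at x)"
  shows "partial_deriv i f x = D (axis i 1)"
  using has_vector_derivative_along_line[of f D x 0 "axis i 1"] assms
  by (simp add: partial_deriv_def vector_derivative_at)

text \<open>Expanding \<open>h\<close> in the standard basis determines the derivative by its values
  on the axes. This is the bridge from the partial derivatives of \<open>C_k_on\<close> to the chain
  rule and the Poincare lemma, which need full derivatives.\<close>

lemma has_derivative_partial_deriv:
  fixes f :: "real^'n \<Rightarrow> 'b::real_normed_vector"
  assumes "f differentiable (at x)"
  shows "(f has_derivative (\<lambda>h. \<Sum>i\<in>UNIV. (h $ i) *\<^sub>R partial_deriv i f x)) (at x)"
proof -
  obtain D where D: "(f has_derivative D) (at x)"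
    using assms by (auto simp: differentiable_def)
  interpret bounded_linear D
    using D by (rule has_derivative_bounded_linear)
  have "D h = (\<Sum>i\<in>UNIV. (h $ i) *\<^sub>R partial_deriv i f x)" for h
  proof -
    have "D h = D (\<Sum>i\<in>UNIV. (h $ i) *\<^sub>R axis i 1)"
      using basis_expansion[of h] by (simp add: scalar_mult_eq_scaleR)
    then show ?thesis
      by (simp add: sum scaleR partial_deriv_eqI[OF D])
  qed
  then have "D = (\<lambda>h. \<Sum>i\<in>UNIV. (h $ i) *\<^sub>R partial_deriv i f x)"
    by blast
  with D show ?thesis
    by simp
qed

text \<open>For small \<open>t\<close> the point \<open>x + t e_i\<close> stays in the open set
  \<open>S\<close>, so only values on \<open>S\<close> enter. This is what permits formulas valid on
  \<open>S\<close> alone to be differentiated again.\<close>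

lemma partial_deriv_cong:
  assumes "open S" "x \<in> S" "\<And>y. y \<in> S \<Longrightarrow> f y = g y"
  shows "partial_deriv i f x = partial_deriv i g x"
proof -
  have "((\<lambda>t. x + t *\<^sub>R axis i 1) \<longlongrightarrow> x + 0 *\<^sub>R axis i 1) (nhds (0::real))"
    by (intro tendsto_intros filterlim_ident)
  then have "\<forall>\<^sub>F t in nhds (0::real). x + t *\<^sub>R axis i 1 \<in> S"
    using assms(1,2) by (auto intro: topological_tendstoD)
  then have "\<forall>\<^sub>F t in nhds (0::real). t \<in> UNIV \<longrightarrow> f (x + t *\<^sub>R axis i 1) = g (x + t *\<^sub>R axis i 1)"
    by eventually_elim (use assms(3) in auto)
  then show ?thesis
    unfolding partial_deriv_def by (intro vector_derivative_cong_eq) auto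
qed

lemma differentiable_cong_open:
  assumes "open S" "x \<in> S" "\<And>y. y \<in> S \<Longrightarrow> f y = g y" "f differentiable (at x)"
  shows "g differentiable (at x)"
  using assms has_derivative_transform_within_open[of f _ x UNIV S g]
  unfolding differentiable_def by blast

lemma C_k_on_cong:
  assumes "open S" "C_k_on k f S" "\<And>x. x \<in> S \<Longrightarrow> f x = g x"
  shows "C_k_on k g S"
  using assms(2,3)
proof (induction k arbitrary: f g)
  case 0
  then show ?case
    using continuous_on_cong[of S S f g] by simp
next
  case (Suc k)
  have "C_k_on k (partial_deriv i g) S" for i
    using Suc.IH[of "partial_deriv i f" "partial_deriv i g"] Suc.prems
      partial_deriv_cong[OF assms(1), of _ f g] by simp
  then show ?case
    using Suc.prems differentiable_cong_open[OF assms(1), of _ f g] by auto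
qed

lemma C_k_on_Suc_imp_continuous_on: "C_k_on (Suc k) f S \<Longrightarrow> continuous_on S f"
  by (auto intro!: differentiable_imp_continuous_on differentiable_at_imp_differentiable_on)

lemma C_k_on_SucD: "C_k_on (Suc k) f S \<Longrightarrow> C_k_on k f S"
proof (induction k arbitrary: f)
  case 0
  then show ?case
    using C_k_on_Suc_imp_continuous_on[of 0 f S] by simp
qed simp

lemma C_k_on_1:
  assumes "C_k_on 1 f S"
  shows "\<And>x. x \<in> S \<Longrightarrow> f differentiable (at x)"
    and "continuous_on S f"
    and "\<And>i. continuous_on S (partial_deriv i f)"
  using assms C_k_on_Suc_imp_continuous_on[of 0 f S] by (auto simp: One_nat_def)

lemma C_k_on_1I:
  assumes "open S"
    and "\<And>x. x \<in> S \<Longrightarrow> f differentiable (at x)"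
    and "\<And>i x. x \<in> S \<Longrightarrow> partial_deriv i f x = d i x"
    and "\<And>i. continuous_on S (d i)"
  shows "C_k_on 1 f S"
proof -
  have "continuous_on S (partial_deriv i f)" for i
    using assms(3,4) continuous_on_cong[of S S "partial_deriv i f" "d i"] by simp
  then show ?thesis
    using assms(2) by (simp add: One_nat_def)
qed

lemma partial_deriv_add:
  assumes "f differentiable (at x)" "g differentiable (at x)"
  shows "partial_deriv i (\<lambda>x. f x + g x) x = partial_deriv i f x + partial_deriv i g x"
proof -
  obtain f' g' where D: "(f has_derivative f') (at x)" "(g has_derivative g') (at x)"
    using assms by (auto simp: differentiable_def)
  show ?thesis
    by (simp add: partial_deriv_eqI[OF D(1)] partial_deriv_eqI[OF D(2)]
        partial_deriv_eqI[OF has_derivative_add[OF D]])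
qed

lemma partial_deriv_diff:
  assumes "f differentiable (at x)" "g differentiable (at x)"
  shows "partial_deriv i (\<lambda>x. f x - g x) x = partial_deriv i f x - partial_deriv i g x"
proof -
  obtain f' g' where D: "(f has_derivative f') (at x)" "(g has_derivative g') (at x)"
    using assms by (auto simp: differentiable_def)
  show ?thesis
    by (simp add: partial_deriv_eqI[OF D(1)] partial_deriv_eqI[OF D(2)]
        partial_deriv_eqI[OF has_derivative_diff[OF D]])
qed

lemma partial_deriv_inner:
  assumes "f differentiable (at x)" "g differentiable (at x)"
  shows "partial_deriv i (\<lambda>x. f x \<bullet> g x) x = f x \<bullet> partial_deriv i g x + partial_deriv i f x \<bullet> g x"
proof -
  obtain f' g' where D: "(f has_derivative f') (at x)" "(g has_derivative g') (at x)"
    using assms by (auto simp: differentiable_def)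
  show ?thesis
    by (simp add: partial_deriv_eqI[OF D(1)] partial_deriv_eqI[OF D(2)]
        partial_deriv_eqI[OF has_derivative_inner[OF D]])
qed

lemma partial_deriv_inner_const:
  assumes "f differentiable (at x)"
  shows "partial_deriv i (\<lambda>x. f x \<bullet> c) x = partial_deriv i f x \<bullet> c"
proof -
  obtain f' where D: "(f has_derivative f') (at x)"
    using assms by (auto simp: differentiable_def)
  show ?thesis
    by (simp add: partial_deriv_eqI[OF D] partial_deriv_eqI[OF has_derivative_inner_left[OF D]])
qed

lemma differentiable_inner_const:
  "f differentiable (at x) \<Longrightarrow> (\<lambda>x. f x \<bullet> c) differentiable (at x)"
  unfolding differentiable_def using has_derivative_inner_left by blast

text \<open>Pairing with a constant vector makes a vector-valued map scalar, and so accessible to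
  the mean value theorem.\<close>

lemma C_k_on_inner_const:
  assumes "open S" "C_k_on k f S"
  shows "C_k_on k (\<lambda>x. f x \<bullet> c) S"
  using assms(2)
proof (induction k arbitrary: f)
  case 0
  then show ?case
    by (auto intro: continuous_intros)
next
  case (Suc k)
  have "C_k_on k (partial_deriv i (\<lambda>x. f x \<bullet> c)) S" for i
    using Suc by (auto intro: C_k_on_cong[OF assms(1), of k "\<lambda>x. partial_deriv i f x \<bullet> c"]
        simp: partial_deriv_inner_const)
  with Suc.prems show ?case
    by (auto intro: differentiable_inner_const)
qed

lemma C_k_on_add:
  assumes "open S" "C_k_on k f S" "C_k_on k g S"
  shows "C_k_on k (\<lambda>x. f x + g x) S"
  using assms(2,3)
proof (induction k arbitrary: f g)
  case 0
  then show ?case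
    by (auto intro: continuous_intros)
next
  case (Suc k)
  have "C_k_on k (partial_deriv i (\<lambda>x. f x + g x)) S" for i
    by (rule C_k_on_cong[OF assms(1) Suc.IH[of "partial_deriv i f" "partial_deriv i g"]])
      (use Suc.prems in \<open>simp_all add: partial_deriv_add\<close>)
  with Suc.prems show ?case
    by (auto intro: differentiable_add)
qed

lemma C_k_on_1_diff:
  assumes "open S" "C_k_on 1 f S" "C_k_on 1 g S"
  shows "C_k_on 1 (\<lambda>x. f x - g x) S"
  by (rule C_k_on_1I[where d = "\<lambda>i x. partial_deriv i f x - partial_deriv i g x"])
    (use assms C_k_on_1[OF assms(2)] C_k_on_1[OF assms(3)] in
      \<open>auto intro!: differentiable_diff continuous_intros partial_deriv_diff\<close>)

lemma C_k_on_1_inner: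
  fixes f g :: "real^'n \<Rightarrow> 'b::real_inner"
  assumes "open S" "C_k_on 1 f S" "C_k_on 1 g S"
  shows "C_k_on 1 (\<lambda>x. f x \<bullet> g x) S"
  by (rule C_k_on_1I[where d = "\<lambda>i x. f x \<bullet> partial_deriv i g x + partial_deriv i f x \<bullet> g x"])
    (use assms C_k_on_1[OF assms(2)] C_k_on_1[OF assms(3)] in
      \<open>auto intro!: differentiable_inner continuous_intros partial_deriv_inner\<close>)

subsection \<open>Symmetry of second derivatives\<close>

text \<open>The mean value theorem is applied twice: in direction \<open>i\<close> to the difference
  of \<open>f\<close> along two parallel segments, then in direction \<open>j\<close> to the
  resulting increment of \<open>partial_deriv i f\<close>. The bound \<open>2 * s < r\<close> keeps
  the whole parallelogram in the ball by the triangle inequality, also when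
  \<open>i = j\<close>.\<close>

lemma second_difference_mean_value:
  fixes f :: "real^'n \<Rightarrow> real"
  assumes f: "\<And>y. y \<in> ball x r \<Longrightarrow> f differentiable (at y)"
    and fi: "\<And>y. y \<in> ball x r \<Longrightarrow> partial_deriv i f differentiable (at y)"
    and s: "0 < s" "2 * s < r"
  shows "\<exists>y. dist x y \<le> 2 * s \<and>
    f (x + s *\<^sub>R axis i 1 + s *\<^sub>R axis j 1) - f (x + s *\<^sub>R axis i 1) - f (x + s *\<^sub>R axis j 1) + f x
    = s\<^sup>2 * partial_deriv j (partial_deriv i f) y"
proof -
  let ?ei = "axis i 1 :: real^'n" and ?ej = "axis j 1 :: real^'n"
  have near: "dist x (x + t *\<^sub>R ?ei + q *\<^sub>R ?ej) \<le> 2 * s"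
    if "0 \<le> t" "t \<le> s" "0 \<le> q" "q \<le> s" for t q
  proof -
    have "norm (t *\<^sub>R ?ei + q *\<^sub>R ?ej) \<le> t + q"
      using norm_triangle_ineq[of "t *\<^sub>R ?ei" "q *\<^sub>R ?ej"] that by (simp add: norm_axis_1)
    moreover have "dist x (x + t *\<^sub>R ?ei + q *\<^sub>R ?ej) = norm (t *\<^sub>R ?ei + q *\<^sub>R ?ej)"
      by (metis (no_types, lifting) add.assoc add_diff_cancel_left' dist_commute dist_norm)
    ultimately show ?thesis
      using that by linarith
  qed
  then have inball: "x + t *\<^sub>R ?ei + q *\<^sub>R ?ej \<in> ball x r"
    if "0 \<le> t" "t \<le> s" "0 \<le> q" "q \<le> s" for t q
    using that s(2) by (smt (verit) mem_ball)
  have line: "((\<lambda>t. g (y + t *\<^sub>R axis k 1)) has_real_derivative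
      partial_deriv k g (y + t *\<^sub>R axis k 1)) (at t)"
    if "g differentiable (at (y + t *\<^sub>R axis k 1))" for g :: "real^'n \<Rightarrow> real" and y k t
  proof -
    obtain D where D: "(g has_derivative D) (at (y + t *\<^sub>R axis k 1))"
      using \<open>g differentiable _\<close> by (auto simp: differentiable_def)
    show ?thesis
      using has_vector_derivative_along_line[OF D]
      by (simp add: partial_deriv_eqI[OF D] has_real_derivative_iff_has_vector_derivative)
  qed
  \<comment> \<open>The increment \<open>g s - g 0\<close> is exactly the second difference of the
    claim.\<close>
  define g where "g t = f (x + s *\<^sub>R ?ej + t *\<^sub>R ?ei) - f (x + t *\<^sub>R ?ei)" for t
  have "\<exists>t>0. t < s \<and> g s - g 0 = (s - 0) *
      (partial_deriv i f (x + s *\<^sub>R ?ej + t *\<^sub>R ?ei) - partial_deriv i f (x + t *\<^sub>R ?ei))"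
  proof (rule MVT2[OF s(1)])
    fix t assume "0 \<le> t" "t \<le> s"
    then show "(g has_real_derivative
      partial_deriv i f (x + s *\<^sub>R ?ej + t *\<^sub>R ?ei) - partial_deriv i f (x + t *\<^sub>R ?ei)) (at t)"
      unfolding g_def using inball[of t s] inball[of t 0] s
      by (intro DERIV_diff line f) (auto simp: ac_simps)
  qed
  then obtain t where t: "0 < t" "t < s" "g s - g 0 = s *
      (partial_deriv i f (x + s *\<^sub>R ?ej + t *\<^sub>R ?ei) - partial_deriv i f (x + t *\<^sub>R ?ei))"
    by auto
  have "\<exists>q>0. q < s \<and> partial_deriv i f (x + t *\<^sub>R ?ei + s *\<^sub>R ?ej)
        - partial_deriv i f (x + t *\<^sub>R ?ei + 0 *\<^sub>R ?ej)
      = (s - 0) * partial_deriv j (partial_deriv i f) (x + t *\<^sub>R ?ei + q *\<^sub>R ?ej)"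
    using inball t by (intro MVT2[OF s(1)] line fi) auto
  then obtain q where q: "0 < q" "q < s" "partial_deriv i f (x + t *\<^sub>R ?ei + s *\<^sub>R ?ej)
        - partial_deriv i f (x + t *\<^sub>R ?ei)
      = s * partial_deriv j (partial_deriv i f) (x + t *\<^sub>R ?ei + q *\<^sub>R ?ej)"
    by auto
  have "g s - g 0 = s\<^sup>2 * partial_deriv j (partial_deriv i f) (x + t *\<^sub>R ?ei + q *\<^sub>R ?ej)"
    using t(3) q(3) by (simp add: power2_eq_square ac_simps)
  then show ?thesis
    using near[of t q] t q
    by (intro exI[of _ "x + t *\<^sub>R ?ei + q *\<^sub>R ?ej"]) (auto simp: g_def ac_simps)
qed

text \<open>The second difference is symmetric in \<open>i\<close> and \<open>j\<close>, so it
  equals the squared step times either mixed derivative, each taken at some point near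
  \<open>x\<close>. Division by the square and continuity of both mixed derivatives give equality in
  the limit.\<close>

lemma partial_deriv_commute_real:
  fixes f :: "real^'n \<Rightarrow> real"
  assumes "open S" "C_k_on 2 f S" "x \<in> S"
  shows "partial_deriv i (partial_deriv j f) x = partial_deriv j (partial_deriv i f) x"
proof -
  have diff: "\<And>y. y \<in> S \<Longrightarrow> f differentiable (at y)"
    "\<And>y k. y \<in> S \<Longrightarrow> partial_deriv k f differentiable (at y)"
    and cont: "\<And>k l. continuous_on S (partial_deriv k (partial_deriv l f))"
    using assms(2) by (auto simp: numeral_2_eq_2)
  obtain r where r: "r > 0" "ball x r \<subseteq> S"
    using assms(1,3) openE by blast
  \<comment> \<open>The shift by 3 yields \<open>2 * s n < r\<close> already for
    \<open>n = 0\<close>.\<close>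
  define s where "s n = r / (3 + real n)" for n
  have s: "0 < s n" "2 * s n < r" for n
    using r(1) by (auto simp: s_def field_simps intro: add_pos_nonneg)
  have "(\<lambda>n. 2 * s n) \<longlonglongrightarrow> 0"
    unfolding s_def by real_asymp
  have ex: "\<exists>y. dist x y \<le> 2 * s n \<and>
      f (x + s n *\<^sub>R axis k 1 + s n *\<^sub>R axis l 1) - f (x + s n *\<^sub>R axis k 1)
        - f (x + s n *\<^sub>R axis l 1) + f x
      = (s n)\<^sup>2 * partial_deriv l (partial_deriv k f) y" for k l n
    by (rule second_difference_mean_value[OF _ _ s]) (use diff r in auto)
  obtain p where p: "\<And>n. dist x (p n) \<le> 2 * s n"
    "\<And>n. f (x + s n *\<^sub>R axis i 1 + s n *\<^sub>R axis j 1) - f (x + s n *\<^sub>R axis i 1)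
        - f (x + s n *\<^sub>R axis j 1) + f x
      = (s n)\<^sup>2 * partial_deriv j (partial_deriv i f) (p n)"
    using ex[of _ i j] by metis
  obtain q where q: "\<And>n. dist x (q n) \<le> 2 * s n"
    "\<And>n. f (x + s n *\<^sub>R axis j 1 + s n *\<^sub>R axis i 1) - f (x + s n *\<^sub>R axis j 1)
        - f (x + s n *\<^sub>R axis i 1) + f x
      = (s n)\<^sup>2 * partial_deriv i (partial_deriv j f) (q n)"
    using ex[of _ j i] by metis
  have eq: "partial_deriv j (partial_deriv i f) (p n) = partial_deriv i (partial_deriv j f) (q n)" for n
  proof -
    have "(s n)\<^sup>2 * partial_deriv j (partial_deriv i f) (p n)
      = (s n)\<^sup>2 * partial_deriv i (partial_deriv j f) (q n)"
      using p(2)[of n] q(2)[of n] by (simp add: algebra_simps)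
    then show ?thesis
      using s(1)[of n] by simp
  qed
  have lim: "w \<longlonglongrightarrow> x" if "\<And>n. dist x (w n) \<le> 2 * s n" for w
    using that tendsto_sandwich[OF _ _ tendsto_const \<open>(\<lambda>n. 2 * s n) \<longlonglongrightarrow> 0\<close>, of "\<lambda>n. dist (w n) x"]
    by (subst tendsto_dist_iff) (auto simp: dist_commute)
  have "isCont (partial_deriv k (partial_deriv l f)) x" for k l
    using cont assms continuous_on_eq_continuous_at by blast
  then have "(\<lambda>n. partial_deriv j (partial_deriv i f) (p n)) \<longlonglongrightarrow> partial_deriv j (partial_deriv i f) x"
    "(\<lambda>n. partial_deriv i (partial_deriv j f) (q n)) \<longlonglongrightarrow> partial_deriv i (partial_deriv j f) x"
    using lim[OF p(1)] lim[OF q(1)] by (auto intro: isCont_tendsto_compose)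
  then show ?thesis
    using LIMSEQ_unique unfolding eq by blast
qed

text \<open>Both sides have the same inner product with every constant vector, by the scalar
  case.\<close>

lemma partial_deriv_commute:
  fixes f :: "real^'n \<Rightarrow> 'b::real_inner"
  assumes "open S" "C_k_on 2 f S" "x \<in> S"
  shows "partial_deriv i (partial_deriv j f) x = partial_deriv j (partial_deriv i f) x"
proof -
  have diff: "\<And>y. y \<in> S \<Longrightarrow> f differentiable (at y)"
    "\<And>y k. y \<in> S \<Longrightarrow> partial_deriv k f differentiable (at y)"
    using assms(2) by (auto simp: numeral_2_eq_2)
  have *: "partial_deriv k (partial_deriv l (\<lambda>x. f x \<bullet> c)) x = partial_deriv k (partial_deriv l f) x \<bullet> c"
    for k l c
  proof -
    have "partial_deriv k (partial_deriv l (\<lambda>x. f x \<bullet> c)) x = partial_deriv k (\<lambda>x. partial_deriv l f x \<bullet> c) x"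
      using diff assms(3) by (intro partial_deriv_cong[OF assms(1)] partial_deriv_inner_const)
    then show ?thesis
      using diff assms(3) by (simp add: partial_deriv_inner_const)
  qed
  have "partial_deriv i (partial_deriv j f) x \<bullet> c = partial_deriv j (partial_deriv i f) x \<bullet> c" for c
    using partial_deriv_commute_real[OF assms(1) C_k_on_inner_const[OF assms(1,2)] assms(3), of i j c]
    by (simp add: *)
  then show ?thesis
    using vector_eq_rdot by blast
qed

subsection \<open>The Poincare lemma in the plane\<close>

text \<open>The potential is the integral of \<open>F (t x) . x\<close> over \<open>t\<close> from 0
  to 1. Differentiating under the integral in direction \<open>h\<close> gives the integrand
  \<open>D x t h\<close>, which by the symmetry of \<open>F'\<close> is the
  \<open>t\<close>-derivative of \<open>t (F (t x) . h)\<close>. The latter is 0 at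
  \<open>t = 0\<close> and \<open>F x . h\<close> at \<open>t = 1\<close>.\<close>

lemma closed_field_has_potential_convex:
  fixes F :: "'a::euclidean_space \<Rightarrow> 'a"
  assumes "convex S" "open S" "0 \<in> S"
    and F: "\<And>x. x \<in> S \<Longrightarrow> (F has_derivative F' x) (at x)"
    and cont: "\<And>h. continuous_on S (\<lambda>x. F' x h)"
    and sym: "\<And>x h k. x \<in> S \<Longrightarrow> F' x h \<bullet> k = F' x k \<bullet> h"
  shows "\<exists>U. \<forall>x\<in>S. (U has_derivative (\<lambda>h. F x \<bullet> h)) (at x)"
proof -
  define D where "D x t h = t *\<^sub>R F' (t *\<^sub>R x) h \<bullet> x + F (t *\<^sub>R x) \<bullet> h" for x h :: 'a and t :: real
  have inS: "t *\<^sub>R x \<in> S" if "x \<in> S" "t \<in> cbox 0 1" for x t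
    using convexD_alt[OF assms(1,3) that(1), of t] that(2) by auto
  have scale: "F' x (t *\<^sub>R h) = t *\<^sub>R F' x h" if "x \<in> S" for x h t
    using F[OF that] has_derivative_bounded_linear linear_simps(5) by blast
  have contF: "continuous_on S F"
    using F by (meson continuous_at_imp_continuous_on has_derivative_continuous)
  have D: "((\<lambda>x. F (t *\<^sub>R x) \<bullet> x) has_derivative D x t) (at x)" if "x \<in> S" "t \<in> cbox 0 1" for x t
  proof -
    have "((\<lambda>x. F (t *\<^sub>R x)) has_derivative (\<lambda>h. F' (t *\<^sub>R x) (t *\<^sub>R h))) (at x)"
      by (rule has_derivative_compose[of "\<lambda>x. t *\<^sub>R x", OF _ F[OF inS[OF that]]])
        (auto intro!: derivative_eq_intros)
    from has_derivative_inner[OF this has_derivative_ident] show ?thesis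
      by (rule has_derivative_eq_rhs) (simp add: D_def scale[OF inS[OF that]] fun_eq_iff)
  qed
  have bl: "bounded_linear (D x t)" if "x \<in> S" "t \<in> cbox 0 1" for x t
    using D[OF that] by (rule has_derivative_bounded_linear)
  have ray: "continuous_on (cbox 0 1) (\<lambda>t. t *\<^sub>R x)" for x :: 'a
    by (intro continuous_intros)
  have "((\<lambda>x. integral (cbox 0 1) (\<lambda>t. F (t *\<^sub>R x) \<bullet> x)) has_derivative (\<lambda>h. F x \<bullet> h)) (at x)"
    if "x \<in> S" for x
  proof -
    \<comment> \<open>Differentiation under the integral asks for continuity of the derivative as an
      operator. In finite dimension continuity on each basis vector suffices, and that is what the
      directionwise hypothesis \<open>cont\<close> gives.\<close>
    have contD: "continuous_on (S \<times> cbox 0 1) (\<lambda>(x, t). Blinfun (D x t))"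
    proof (rule continuous_on_blinfun_componentwise)
      fix i :: 'a
      have sc: "continuous_on (S \<times> cbox 0 1) (\<lambda>p. snd p *\<^sub>R fst p)"
        by (intro continuous_intros)
      have "(\<lambda>p. snd p *\<^sub>R fst p) ` (S \<times> cbox 0 1) \<subseteq> S"
        using inS by auto
      then have "continuous_on (S \<times> cbox 0 1) (\<lambda>p. D (fst p) (snd p) i)"
        unfolding D_def
        by (intro continuous_intros continuous_on_compose2[OF contF sc]
            continuous_on_compose2[OF cont sc])
      then show "continuous_on (S \<times> cbox 0 1) (\<lambda>p. blinfun_apply (case p of (x, t) \<Rightarrow> Blinfun (D x t)) i)"
        by (rule continuous_on_eq) (auto simp: bounded_linear_Blinfun_apply bl simp del: cbox_interval)
    qed
    have "((\<lambda>x. integral (cbox 0 1) (\<lambda>t. F (t *\<^sub>R x) \<bullet> x)) has_derivative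
        integral (cbox 0 1) (\<lambda>t. Blinfun (D x t))) (at x within S)"
    proof (rule leibniz_rule[OF _ _ contD that assms(1)])
      fix y t assume yt: "y \<in> S" "t \<in> cbox (0::real) 1"
      show "((\<lambda>x. F (t *\<^sub>R x) \<bullet> x) has_derivative blinfun_apply (Blinfun (D y t))) (at y within S)"
        using D[OF yt] bl[OF yt] by (simp add: bounded_linear_Blinfun_apply has_derivative_at_withinI)
    next
      fix y assume "y \<in> S"
      then show "(\<lambda>t. F (t *\<^sub>R y) \<bullet> y) integrable_on cbox 0 1"
        using inS by (intro integrable_continuous continuous_intros continuous_on_compose2[OF contF ray]) auto
    qed
    moreover have "blinfun_apply (integral (cbox 0 1) (\<lambda>t. Blinfun (D x t))) h = F x \<bullet> h" for h
    proof -
      have "continuous_on (cbox 0 1) (\<lambda>t :: real. (x, t))"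
        by (intro continuous_intros)
      then have "continuous_on (cbox 0 1) (\<lambda>t. Blinfun (D x t))"
        using continuous_on_compose2[OF contD, of "cbox 0 1" "\<lambda>t. (x, t)"] that by auto
      then have "blinfun_apply (integral (cbox 0 1) (\<lambda>t. Blinfun (D x t))) h
          = integral (cbox 0 1) (\<lambda>t. blinfun_apply (Blinfun (D x t)) h)"
        by (intro blinfun_apply_integral integrable_continuous)
      also have "\<dots> = integral (cbox 0 1) (\<lambda>t. D x t h)"
        by (intro integral_cong) (use bl that in \<open>auto simp: bounded_linear_Blinfun_apply\<close>)
      also have "((\<lambda>t. D x t h) has_integral 1 *\<^sub>R (F (1 *\<^sub>R x) \<bullet> h) - 0 *\<^sub>R (F (0 *\<^sub>R x) \<bullet> h)) {0..1}"
      proof (rule fundamental_theorem_of_calculus)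
        fix t :: real assume "t \<in> {0..1}"
        then have txS: "t *\<^sub>R x \<in> S"
          using inS that by auto
        have "((\<lambda>t. F (t *\<^sub>R x)) has_derivative (\<lambda>s. F' (t *\<^sub>R x) (s *\<^sub>R x))) (at t)"
          by (rule has_derivative_compose[of "\<lambda>t. t *\<^sub>R x", OF _ F[OF txS]])
            (auto intro!: derivative_eq_intros)
        then have "((\<lambda>t. t *\<^sub>R (F (t *\<^sub>R x) \<bullet> h)) has_derivative
            (\<lambda>s. t *\<^sub>R (F' (t *\<^sub>R x) (s *\<^sub>R x) \<bullet> h) + s *\<^sub>R (F (t *\<^sub>R x) \<bullet> h))) (at t)"
          by (intro derivative_eq_intros) (auto simp: algebra_simps)
        \<comment> \<open>Closedness enters here: it exchanges \<open>x\<close> and \<open>h\<close>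
          in \<open>F' (t x) x . h\<close>.\<close>
        also have "(\<lambda>s. t *\<^sub>R (F' (t *\<^sub>R x) (s *\<^sub>R x) \<bullet> h) + s *\<^sub>R (F (t *\<^sub>R x) \<bullet> h)) = (\<lambda>s. s *\<^sub>R D x t h)"
          using sym[OF txS, of x h] by (auto simp: D_def scale txS algebra_simps)
        finally show "((\<lambda>t. t *\<^sub>R (F (t *\<^sub>R x) \<bullet> h)) has_vector_derivative D x t h) (at t within {0..1})"
          by (simp add: has_vector_derivative_def has_derivative_at_withinI)
      qed simp
      then have "integral (cbox 0 1) (\<lambda>t. D x t h) = F x \<bullet> h"
        by (simp add: integral_unique)
      finally show ?thesis .
    qed
    then have "blinfun_apply (integral (cbox 0 1) (\<lambda>t. Blinfun (D x t))) = (\<lambda>h. F x \<bullet> h)"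
      by blast
    ultimately show ?thesis
      unfolding at_within_open[OF that assms(2)] by (simp only:)
  qed
  then show ?thesis
    by blast
qed

text \<open>The pullback of a closed field under a holomorphic \<open>g\<close> is \<open>z \<mapsto> cnj (g' z) * F (g z)\<close>, which is again
  closed; with \<open>g\<close> the Riemann map, this reduces the simply connected case to the disc.\<close>

lemma closed_field_has_potential_complex:
  fixes F :: "complex \<Rightarrow> complex"
  assumes "open S" "simply_connected S"
    and F: "\<And>z. z \<in> S \<Longrightarrow> (F has_derivative F' z) (at z)"
    and cont: "\<And>h. continuous_on S (\<lambda>z. F' z h)"
    and sym: "\<And>z h k. z \<in> S \<Longrightarrow> F' z h \<bullet> k = F' z k \<bullet> h"
  shows "\<exists>U. \<forall>z\<in>S. (U has_derivative (\<lambda>h. F z \<bullet> h)) (at z)"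
proof -
  \<comment> \<open>Multiplication by \<open>cnj a\<close> is the real transpose of multiplication
    by \<open>a\<close>; hence the conjugate in the pulled-back field.\<close>
  have inner_mult: "(cnj a * b) \<bullet> c = b \<bullet> (a * c)" for a b c :: complex
    by (simp add: inner_complex_def algebra_simps)
  \<comment> \<open>The alternatives of the Riemann mapping theorem. The whole plane is not
    biholomorphic to the disc, but it is convex, so ray integration applies to it directly.\<close>
  consider "S = {}" | "S = UNIV" | f g where
    "f holomorphic_on S" "g holomorphic_on ball 0 1"
    "\<forall>z\<in>S. f z \<in> ball 0 1 \<and> g (f z) = z" "\<forall>z\<in>ball 0 1. g z \<in> S \<and> f (g z) = z"
    using iffD1[OF simply_connected_eq_biholomorphic_to_disc[OF assms(1)] assms(2)]
    by (elim disjE exE conjE) (rule that; assumption)+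
  then show ?thesis
  proof cases
    case 2
    then show ?thesis
      using closed_field_has_potential_convex[of S F F'] F cont sym by simp
  next
    case 3
    let ?B = "ball (0::complex) 1"
    define G where "G z = cnj (deriv g z) * F (g z)" for z
    define G' where "G' z k = cnj (deriv (deriv g) z * k) * F (g z) + cnj (deriv g z) * F' (g z) (deriv g z * k)" for z k
    have holg': "deriv g holomorphic_on ?B" "deriv (deriv g) holomorphic_on ?B"
      using 3(2) by (auto intro!: holomorphic_deriv)
    have contg: "continuous_on ?B g" "continuous_on ?B (deriv g)" "continuous_on ?B (deriv (deriv g))"
      using 3(2) holg' by (auto intro: holomorphic_on_imp_continuous_on)
    have gB: "g ` ?B \<subseteq> S"
      using 3(4) by auto
    have contF: "continuous_on S F"
      using F by (meson continuous_at_imp_continuous_on has_derivative_continuous)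
    have deriv_g: "(g has_derivative (\<lambda>k. deriv g z * k)) (at z)"
      "(deriv g has_derivative (\<lambda>k. deriv (deriv g) z * k)) (at z)" if "z \<in> ?B" for z
      using holomorphic_derivI[OF 3(2) open_ball that] holomorphic_derivI[OF holg'(1) open_ball that]
      by (simp_all add: has_field_derivative_def)
    \<comment> \<open>In \<open>G'\<close> the direction \<open>deriv g z * k\<close> varies with
      \<open>z\<close>, whereas \<open>cont\<close> speaks of fixed directions. Splitting into the
      directions 1 and \<open>\<i>\<close> leaves continuous real coefficients.\<close>
    have F'_split: "F' w c = Re c *\<^sub>R F' w 1 + Im c *\<^sub>R F' w \<i>" if "w \<in> S" for w c
    proof -
      interpret bounded_linear "F' w"
        using F[OF that] by (rule has_derivative_bounded_linear)
      have "c = Re c *\<^sub>R 1 + Im c *\<^sub>R \<i>"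
        by (simp add: complex_eq_iff)
      then show ?thesis
        by (metis add scaleR)
    qed
    have "\<exists>V. \<forall>z\<in>?B. (V has_derivative (\<lambda>h. G z \<bullet> h)) (at z)"
    proof (rule closed_field_has_potential_convex)
      fix z assume z: "z \<in> ?B"
      then have gz: "g z \<in> S"
        using 3(4) by blast
      have "((\<lambda>z. F (g z)) has_derivative (\<lambda>k. F' (g z) (deriv g z * k))) (at z)"
        by (rule has_derivative_compose[OF deriv_g(1)[OF z] F[OF gz]])
      from has_derivative_mult[OF has_derivative_cnj[OF deriv_g(2)[OF z]] this]
      show "(G has_derivative G' z) (at z)"
        unfolding G_def G'_def by (rule has_derivative_eq_rhs) auto
      \<comment> \<open>After transposition the first summand is \<open>F (g z) . (g'' h k)\<close>,
        symmetric because complex multiplication commutes; the second is symmetric by closedness of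
        \<open>F\<close> in the directions \<open>g' h\<close> and \<open>g' k\<close>.\<close>
      show "G' z h \<bullet> k = G' z k \<bullet> h" for h k
        unfolding G'_def inner_add_left
        using sym[OF gz, of "deriv g z * h" "deriv g z * k"]
        by (simp only: inner_mult) (simp add: inner_complex_def algebra_simps)
    next
      fix h
      have "continuous_on ?B (\<lambda>z. cnj (deriv (deriv g) z * h) * F (g z)
        + cnj (deriv g z) * (Re (deriv g z * h) *\<^sub>R F' (g z) 1 + Im (deriv g z * h) *\<^sub>R F' (g z) \<i>))"
        using contg gB
        by (intro continuous_intros continuous_on_compose2[OF contF] continuous_on_compose2[OF cont]) auto
      then show "continuous_on ?B (\<lambda>z. G' z h)"
      proof (rule continuous_on_eq)
        fix z assume "z \<in> ?B"
        then have "g z \<in> S"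
          using gB by blast
        from F'_split[OF this, of "deriv g z * h"]
        show "cnj (deriv (deriv g) z * h) * F (g z)
          + cnj (deriv g z) * (Re (deriv g z * h) *\<^sub>R F' (g z) 1 + Im (deriv g z * h) *\<^sub>R F' (g z) \<i>) = G' z h"
          by (simp only: G'_def)
      qed
    qed auto
    then obtain V where V: "\<And>z. z \<in> ?B \<Longrightarrow> (V has_derivative (\<lambda>h. G z \<bullet> h)) (at z)"
      by blast
    have "((\<lambda>w. V (f w)) has_derivative (\<lambda>h. F w \<bullet> h)) (at w)" if "w \<in> S" for w
    proof -
      have fw: "f w \<in> ?B" "g (f w) = w"
        using 3(3) that by auto
      have f: "(f has_derivative (\<lambda>h. deriv f w * h)) (at w)"
        using holomorphic_derivI[OF 3(1) assms(1) that] by (simp add: has_field_derivative_def)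
      \<comment> \<open>Differentiating \<open>g (f w) = w\<close> shows that the derivatives of
        \<open>g\<close> and \<open>f\<close> are reciprocal, so pulling \<open>G\<close> back by
        \<open>f\<close> undoes the pullback by \<open>g\<close>.\<close>
      have "((\<lambda>w. g (f w)) has_derivative (\<lambda>h. deriv g (f w) * (deriv f w * h))) (at w)"
        by (rule has_derivative_compose[OF f deriv_g(1)[OF fw(1)]])
      moreover have "((\<lambda>w. g (f w)) has_derivative (\<lambda>h. h)) (at w)"
        by (rule has_derivative_transform_within_open[OF has_derivative_ident assms(1) that])
          (use 3(3) in auto)
      ultimately have "deriv g (f w) * (deriv f w * h) = h" for h
        using has_derivative_unique by metis
      then have "G (f w) \<bullet> (deriv f w * h) = F w \<bullet> h" for h
        by (simp only: G_def fw(2) inner_mult)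
      then show ?thesis
        using has_derivative_compose[OF f V[OF fw(1)]] by simp
    qed
    then show ?thesis
      by blast
  qed auto
qed

text \<open>The linear isometry \<open>J\<close> with inverse \<open>T\<close> identifies the real
  plane with the complex one. Since \<open>J\<close> and \<open>T\<close> are also adjoint, symmetry
  of the derivative and the gradient formula carry over unchanged.\<close>

lemma closed_field_has_potential:
  fixes F :: "real^2 \<Rightarrow> real^2"
  assumes "open S" "simply_connected S"
    and F: "\<And>x. x \<in> S \<Longrightarrow> (F has_derivative F' x) (at x)"
    and cont: "\<And>h. continuous_on S (\<lambda>x. F' x h)"
    and sym: "\<And>x h k. x \<in> S \<Longrightarrow> F' x h \<bullet> k = F' x k \<bullet> h"
  shows "\<exists>U. \<forall>x\<in>S. (U has_derivative (\<lambda>h. F x \<bullet> h)) (at x)"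
proof -
  define T :: "complex \<Rightarrow> real^2" where "T z = Re z *\<^sub>R axis 1 1 + Im z *\<^sub>R axis 2 1" for z
  define J :: "real^2 \<Rightarrow> complex" where "J x = Complex (x $ 1) (x $ 2)" for x
  have TJ: "T (J x) = x" and JT: "J (T z) = z" for x z
    by (auto simp: T_def J_def vec_eq_iff forall_2 axis_def)
  have inner: "J x \<bullet> z = x \<bullet> T z" for x z
    by (simp add: T_def J_def inner_complex_def inner_vec_def sum_2 axis_def)
  have "linear T" "linear J"
    by (auto intro!: linearI simp: T_def J_def complex_eq_iff algebra_simps)
  then have T: "bounded_linear T" and J: "bounded_linear J"
    by (simp_all add: linear_conv_bounded_linear)
  define S' where "S' = J ` S"
  have S': "z \<in> S' \<longleftrightarrow> T z \<in> S" for z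
    unfolding S'_def image_iff by (metis TJ JT)
  have contTJ: "continuous_on A T" "continuous_on B J" for A B
    using T J by (auto intro: linear_continuous_on)
  have "S' = T -` S"
    using S' by auto
  then have "open S'"
    using open_vimage[OF assms(1) contTJ(1)] by simp
  have "homeomorphism S S' J T"
    by (auto simp: homeomorphism_def S'_def TJ contTJ image_image)
  then have "simply_connected S'"
    using assms(2) homeomorphic_simply_connected homeomorphic_def by blast
  have "\<exists>V. \<forall>z\<in>S'. (V has_derivative (\<lambda>h. J (F (T z)) \<bullet> h)) (at z)"
  proof (rule closed_field_has_potential_complex[OF \<open>open S'\<close> \<open>simply_connected S'\<close>,
        where F' = "\<lambda>z h. J (F' (T z) (T h))"])
    fix z assume "z \<in> S'"
    then have z: "T z \<in> S"
      by (simp add: S')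
    show "((\<lambda>z. J (F (T z))) has_derivative (\<lambda>h. J (F' (T z) (T h)))) (at z)"
      by (intro bounded_linear.has_derivative[OF J]
          has_derivative_compose[OF bounded_linear_imp_has_derivative[OF T] F[OF z]])
    show "J (F' (T z) (T h)) \<bullet> k = J (F' (T z) (T k)) \<bullet> h" for h k
      by (simp add: inner sym[OF z])
  next
    show "continuous_on S' (\<lambda>z. J (F' (T z) (T h)))" for h
      by (intro continuous_on_compose2[OF contTJ(2)[of UNIV]] continuous_on_compose2[OF cont contTJ(1)])
        (auto simp: S')
  qed
  then obtain V where V: "\<And>z. z \<in> S' \<Longrightarrow> (V has_derivative (\<lambda>h. J (F (T z)) \<bullet> h)) (at z)"
    by blast
  have "((\<lambda>x. V (J x)) has_derivative (\<lambda>h. F x \<bullet> h)) (at x)" if "x \<in> S" for x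
    using has_derivative_compose[OF bounded_linear_imp_has_derivative[OF J] V[of "J x"]] that
    by (simp add: S'_def TJ inner)
  then show ?thesis
    by blast
qed

text \<open>For the field \<open>(P, Q)\<close> symmetry of the derivative is equality of the two
  cross derivatives.\<close>

lemma gradient_exists:
  fixes P Q :: "real^2 \<Rightarrow> real"
  assumes "open S" "simply_connected S" "C_k_on 1 P S" "C_k_on 1 Q S"
    and closed: "\<And>x. x \<in> S \<Longrightarrow> partial_deriv 2 P x = partial_deriv 1 Q x"
  obtains U where "\<And>x. x \<in> S \<Longrightarrow> U differentiable (at x)"
    "\<And>x. x \<in> S \<Longrightarrow> partial_deriv 1 U x = P x" "\<And>x. x \<in> S \<Longrightarrow> partial_deriv 2 U x = Q x"
proof -
  let ?D = "\<lambda>P x h. \<Sum>i\<in>UNIV. (h $ i) *\<^sub>R partial_deriv i P x"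
  have "\<exists>U. \<forall>x\<in>S. (U has_derivative (\<lambda>h. (P x *\<^sub>R axis 1 1 + Q x *\<^sub>R axis 2 1) \<bullet> h)) (at x)"
  proof (rule closed_field_has_potential[OF assms(1,2),
        where F' = "\<lambda>x h. ?D P x h *\<^sub>R axis 1 1 + ?D Q x h *\<^sub>R axis 2 1"])
    fix x assume x: "x \<in> S"
    show "((\<lambda>x. P x *\<^sub>R axis 1 1 + Q x *\<^sub>R axis 2 1) has_derivative
        (\<lambda>h. ?D P x h *\<^sub>R axis 1 1 + ?D Q x h *\<^sub>R axis 2 1)) (at x)"
      using has_derivative_partial_deriv[OF C_k_on_1(1)[OF assms(3) x]]
        has_derivative_partial_deriv[OF C_k_on_1(1)[OF assms(4) x]]
      by (intro has_derivative_add has_derivative_scaleR_left)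
    show "(?D P x h *\<^sub>R axis 1 1 + ?D Q x h *\<^sub>R axis 2 1) \<bullet> k
      = (?D P x k *\<^sub>R axis 1 1 + ?D Q x k *\<^sub>R axis 2 1) \<bullet> h" for h k
      using closed[OF x] by (simp add: sum_2 inner_add_left inner_axis' algebra_simps)
  next
    show "continuous_on S (\<lambda>x. ?D P x h *\<^sub>R axis 1 1 + ?D Q x h *\<^sub>R (axis 2 1 :: real^2))" for h
      using C_k_on_1(3)[OF assms(3)] C_k_on_1(3)[OF assms(4)] by (intro continuous_intros)
  qed
  then obtain U where U: "\<And>x. x \<in> S \<Longrightarrow>
      (U has_derivative (\<lambda>h. (P x *\<^sub>R axis 1 1 + Q x *\<^sub>R axis 2 1) \<bullet> h)) (at x)"
    by blast
  show ?thesis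
  proof (rule that[of U])
    fix x assume "x \<in> S"
    from U[OF this] show "U differentiable (at x)"
      by (auto simp: differentiable_def)
    show "partial_deriv 1 U x = P x" "partial_deriv 2 U x = Q x"
      using partial_deriv_eqI[OF U[OF \<open>x \<in> S\<close>]]
      by (simp_all add: inner_add_left inner_axis_axis)
  qed
qed

section \<open>Symmetric matrix fields as Hessians\<close>

lemma symmetric_field_is_hessian:
  fixes A B C :: "real^2 \<Rightarrow> real"
  assumes "open S" "simply_connected S" "C_k_on 1 A S" "C_k_on 1 B S" "C_k_on 1 C S"
    and AB: "\<And>x. x \<in> S \<Longrightarrow> partial_deriv 2 A x = partial_deriv 1 B x"
    and BC: "\<And>x. x \<in> S \<Longrightarrow> partial_deriv 2 B x = partial_deriv 1 C x"
  obtains U where "C_k_on 3 U S"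
    "\<And>x. x \<in> S \<Longrightarrow> hessian U x = vector [vector [A x, B x], vector [B x, C x]]"
proof -
  obtain p where p: "\<And>x. x \<in> S \<Longrightarrow> p differentiable (at x)"
    "\<And>x. x \<in> S \<Longrightarrow> partial_deriv 1 p x = A x" "\<And>x. x \<in> S \<Longrightarrow> partial_deriv 2 p x = B x"
    using gradient_exists[OF assms(1-4) AB] by blast
  obtain q where q: "\<And>x. x \<in> S \<Longrightarrow> q differentiable (at x)"
    "\<And>x. x \<in> S \<Longrightarrow> partial_deriv 1 q x = B x" "\<And>x. x \<in> S \<Longrightarrow> partial_deriv 2 q x = C x"
    using gradient_exists[OF assms(1,2,4,5) BC] by blast
  \<comment> \<open>Each integration gains one order of differentiability, since the new gradient is
    known: from C^1 entries to C^2 functions \<open>p\<close> and \<open>q\<close>, then to a C^3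
    function \<open>U\<close>.\<close>
  have C_Suc: "C_k_on (Suc k) f S"
    if "\<And>x. x \<in> S \<Longrightarrow> f differentiable (at x)" "\<And>x. x \<in> S \<Longrightarrow> partial_deriv 1 f x = g x"
      "\<And>x. x \<in> S \<Longrightarrow> partial_deriv 2 f x = h x" "C_k_on k g S" "C_k_on k h S" for k f g h
    using that C_k_on_cong[OF assms(1), of k g "partial_deriv 1 f"]
      C_k_on_cong[OF assms(1), of k h "partial_deriv 2 f"] by (simp add: forall_2)
  have p2: "C_k_on 2 p S" and q2: "C_k_on 2 q S"
    using C_Suc[of p A B 1] C_Suc[of q B C 1] p q assms(3-5) by (simp_all add: numeral_2_eq_2)
  obtain U where U: "\<And>x. x \<in> S \<Longrightarrow> U differentiable (at x)"
    "\<And>x. x \<in> S \<Longrightarrow> partial_deriv 1 U x = p x" "\<And>x. x \<in> S \<Longrightarrow> partial_deriv 2 U x = q x"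
  proof (rule gradient_exists[OF assms(1,2), of p q])
    show "C_k_on 1 p S" "C_k_on 1 q S"
      using C_Suc[of p A B 0] C_Suc[of q B C 0] p q
        C_k_on_1(2)[OF assms(3)] C_k_on_1(2)[OF assms(4)] C_k_on_1(2)[OF assms(5)] by simp_all
  qed (use p q in auto)
  have "C_k_on 3 U S"
    using C_Suc[of U p q 2] U p2 q2 by (simp add: numeral_3_eq_3 numeral_2_eq_2)
  moreover have "hessian U x = vector [vector [A x, B x], vector [B x, C x]]" if "x \<in> S" for x
  proof -
    have "partial_deriv j (partial_deriv 1 U) x = partial_deriv j p x"
      "partial_deriv j (partial_deriv 2 U) x = partial_deriv j q x" for j
      using U by (auto intro!: partial_deriv_cong[OF assms(1) that])
    then show ?thesis
      using p q that by (simp add: hessian_def vec_eq_iff forall_2)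
  qed
  ultimately show ?thesis
    by (rule that)
qed

section \<open>The Hessian determines a function up to affine terms\<close>

lemma equal_hessians_imp_affine_difference:
  fixes f g :: "real^'n \<Rightarrow> real"
  assumes "open S" "connected S" "C_k_on 2 f S" "C_k_on 2 g S"
    and hess: "\<And>x. x \<in> S \<Longrightarrow> hessian f x = hessian g x"
  shows "\<exists>a b. \<forall>x\<in>S. f x = g x + a \<bullet> x + b"
proof (cases "S = {}")
  case False
  then obtain z where z: "z \<in> S"
    by blast
  have diff: "f differentiable (at x)" "g differentiable (at x)"
    "partial_deriv i f differentiable (at x)" "partial_deriv i g differentiable (at x)"
    if "x \<in> S" for x i
    using assms(3,4) that by (auto simp: numeral_2_eq_2)
  \<comment> \<open>Connectedness is used through this fact twice: the first derivatives of
    \<open>f - g\<close> are constant and form the vector \<open>a\<close>, and then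
    \<open>f - g\<close> minus the linear part is constant.\<close>
  have const: "h x = h z"
    if "\<And>y. y \<in> S \<Longrightarrow> h differentiable (at y)" "\<And>y i. y \<in> S \<Longrightarrow> partial_deriv i h y = 0" "x \<in> S"
    for h :: "real^'n \<Rightarrow> real" and x
    using has_derivative_zero_unique_connected[OF assms(1,2) _ that(3) z, of h]
      has_derivative_partial_deriv[OF that(1)] that(2) by simp
  define a where "a = (\<chi> i. partial_deriv i f z - partial_deriv i g z)"
  have grad: "partial_deriv i f x - partial_deriv i g x = a $ i" if "x \<in> S" for x i
  proof -
    have "partial_deriv j (partial_deriv i f) y = partial_deriv j (partial_deriv i g) y" if "y \<in> S" for y j
      using hess[OF that] by (simp add: hessian_def vec_eq_iff)
    then show ?thesis
      using const[of "\<lambda>x. partial_deriv i f x - partial_deriv i g x" x] diff that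
      by (simp add: a_def partial_deriv_diff)
  qed
  have lin: "(\<lambda>y. y \<bullet> a) differentiable (at x)" "partial_deriv i (\<lambda>y. y \<bullet> a) x = a $ i" for x i
    by (auto simp: partial_deriv_inner_const partial_deriv_eqI[OF has_derivative_ident] inner_axis'
        intro: differentiable_inner_const)
  have "f x - g x - x \<bullet> a = f z - g z - z \<bullet> a" if "x \<in> S" for x
    using diff lin grad that
    by (intro const[of "\<lambda>x. f x - g x - x \<bullet> a"])
      (auto simp: partial_deriv_diff)
  then have "\<forall>x\<in>S. f x = g x + a \<bullet> x + (f z - g z - z \<bullet> a)"
    by (auto simp: inner_commute algebra_simps)
  then show ?thesis
    by blast
qed auto

lemma C_k_on_affine: "C_k_on k (\<lambda>x. a \<bullet> x + b :: real) S"
proof -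
  have const: "C_k_on k (\<lambda>x. c :: real) S" for k and c :: real
  proof (induction k arbitrary: c)
    case (Suc k)
    have "partial_deriv i (\<lambda>x. c) = (\<lambda>x. 0)" for i :: 'a
      using partial_deriv_eqI[OF has_derivative_const] by blast
    with Suc show ?case
      by simp
  qed auto
  have D: "((\<lambda>x. a \<bullet> x + b) has_derivative (\<lambda>h. a \<bullet> h)) (at x)" for x
    by (auto intro!: derivative_eq_intros)
  then have "partial_deriv i (\<lambda>x. a \<bullet> x + b) = (\<lambda>x. a $ i)" for i
    using partial_deriv_eqI[OF D] by (auto simp: inner_axis)
  with D const show ?thesis
    by (cases k) (auto simp: differentiable_def intro!: continuous_intros)
qed

lemma hessian_add_affine:
  fixes f :: "real^'n \<Rightarrow> real"
  assumes "open S" "C_k_on 2 f S" "x \<in> S"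
  shows "hessian (\<lambda>x. f x + (a \<bullet> x + b)) x = hessian f x"
proof -
  have D: "((\<lambda>x. a \<bullet> x + b) has_derivative (\<lambda>h. a \<bullet> h)) (at x)" for x
    by (auto intro!: derivative_eq_intros)
  then have affine: "(\<lambda>x. a \<bullet> x + b) differentiable (at x)" for x
    unfolding differentiable_def by blast
  have diff: "f differentiable (at x)" "partial_deriv i f differentiable (at x)" if "x \<in> S" for x i
    using assms(2) that by (auto simp: numeral_2_eq_2)
  have "partial_deriv j (partial_deriv i (\<lambda>x. f x + (a \<bullet> x + b))) x
    = partial_deriv j (\<lambda>x. partial_deriv i f x + a $ i) x" for i j
    using diff affine
    by (intro partial_deriv_cong[OF assms(1,3)])
      (simp add: partial_deriv_add partial_deriv_eqI[OF D] inner_axis)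
  also have "partial_deriv j (\<lambda>x. partial_deriv i f x + a $ i) x = partial_deriv j (partial_deriv i f) x" for i j
    using diff assms(3) partial_deriv_eqI[OF has_derivative_const] by (simp add: partial_deriv_add)
  finally show ?thesis
    by (simp add: hessian_def)
qed

subsection \<open>The Hessian field of a solution\<close>

text \<open>The equation replaces the gradient of \<open>W\<close> in the chain rule by the
  Laplacian of \<open>u\<close>, so the partial derivatives of \<open>W (u x)\<close> are continuous
  because \<open>u\<close> is C^2.\<close>

lemma C_k_on_potential_along_solution:
  fixes W :: "real^'m \<Rightarrow> real" and u :: "real^'n \<Rightarrow> real^'m"
  assumes "open S" "C_k_on 2 u S" and W: "\<And>x. x \<in> S \<Longrightarrow> GDERIV W (u x) :> laplacian u x"
  shows "C_k_on 1 (\<lambda>x. W (u x)) S"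
    and "x \<in> S \<Longrightarrow> partial_deriv i (\<lambda>x. W (u x)) x = laplacian u x \<bullet> partial_deriv i u x"
proof -
  have u: "\<And>y. y \<in> S \<Longrightarrow> u differentiable (at y)"
    "\<And>k. continuous_on S (partial_deriv k u)"
    "\<And>k l. continuous_on S (partial_deriv k (partial_deriv l u))"
    using assms(2) C_k_on_Suc_imp_continuous_on[of 0 "partial_deriv _ u" S]
    by (auto simp: numeral_2_eq_2)
  have "((\<lambda>x. W (u x)) has_derivative
      (\<lambda>h. (\<Sum>i\<in>UNIV. (h $ i) *\<^sub>R partial_deriv i u x) \<bullet> laplacian u x)) (at x)" if "x \<in> S" for x
    using has_derivative_compose[OF has_derivative_partial_deriv[OF u(1)[OF that]]] W[OF that]
    by (simp add: gderiv_def)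
  note D = this
  show pd: "partial_deriv i (\<lambda>x. W (u x)) x = laplacian u x \<bullet> partial_deriv i u x" if "x \<in> S" for x i
    using partial_deriv_eqI[OF D[OF that], of i]
    by (simp add: axis_def if_distrib[where f = "\<lambda>c. c *\<^sub>R _"] inner_commute cong: if_cong)
  show "C_k_on 1 (\<lambda>x. W (u x)) S"
    using D u(2,3)
    by (intro C_k_on_1I[OF assms(1) _ pd])
      (auto simp: differentiable_def laplacian_def intro!: continuous_intros)
qed

theorem mainTheorem7:
  fixes \<Omega> :: "(real^2) set"
    and W :: "real^'m \<Rightarrow> real"
    and u :: "real^2 \<Rightarrow> real^'m"
  assumes "open \<Omega>" and "connected \<Omega>" and "simply_connected \<Omega>"
    and "C_k_on 1 W UNIV"
    and "C_k_on 2 u \<Omega>"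
    and "\<forall>x\<in>\<Omega>. GDERIV W (u x) :> laplacian u x"
  shows "(\<exists>U. hessian_potential \<Omega> W u U \<and>
             (\<forall>V. hessian_potential \<Omega> W u V \<longleftrightarrow>
                   (\<exists>a b. \<forall>x\<in>\<Omega>. V x = U x + a \<bullet> x + b))) \<and>
         (\<forall>U. hessian_potential \<Omega> W u U \<longrightarrow> (\<forall>x\<in>\<Omega>. laplacian U x = 4 * W (u x)))"
proof -
  let ?u1 = "partial_deriv 1 u" and ?u2 = "partial_deriv 2 u"
  define w where "w x = W (u x)" for x
  \<comment> \<open>The doubled terms are written as sums, so that the rules for sums, differences
    and inner products cover all entries.\<close>
  define A where "A x = ?u1 x \<bullet> ?u1 x - ?u2 x \<bullet> ?u2 x + (w x + w x)" for x
  define B where "B x = ?u1 x \<bullet> ?u2 x + ?u1 x \<bullet> ?u2 x" for x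
  define C where "C x = ?u2 x \<bullet> ?u2 x - ?u1 x \<bullet> ?u1 x + (w x + w x)" for x
  have u1: "C_k_on 1 (partial_deriv i u) \<Omega>" for i
    using assms(5) by (simp add: numeral_2_eq_2)
  have w: "C_k_on 1 w \<Omega>"
    "\<And>x i. x \<in> \<Omega> \<Longrightarrow> partial_deriv i w x = laplacian u x \<bullet> partial_deriv i u x"
    unfolding w_def using C_k_on_potential_along_solution[OF assms(1,5), of W] assms(6) by blast+
  have C1: "C_k_on 1 A \<Omega>" "C_k_on 1 B \<Omega>" "C_k_on 1 C \<Omega>"
    unfolding A_def B_def C_def
    by (intro C_k_on_add C_k_on_1_diff C_k_on_1_inner u1 w(1) assms(1))+
  have field: "hessian_field W u x = vector [vector [A x, B x], vector [B x, C x]]" for x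
    by (simp add: hessian_field_def Let_def A_def B_def C_def w_def power2_norm_eq_inner)
  have closed: "partial_deriv 2 A x = partial_deriv 1 B x" "partial_deriv 2 B x = partial_deriv 1 C x"
    if "x \<in> \<Omega>" for x
  proof -
    note d = C_k_on_1(1)[OF u1 that] C_k_on_1(1)[OF w(1) that]
    have "partial_deriv 1 ?u2 x = partial_deriv 2 ?u1 x"
      using partial_deriv_commute[OF assms(1,5) that] .
    \<comment> \<open>With \<open>u_ij\<close> for the second derivatives and
      \<open>u_12 = u_21\<close>, the first defect is
      \<open>2 u_2 . (Laplacian u - u_11 - u_22)\<close> and the second is
      \<open>2 u_1 . (u_11 + u_22 - Laplacian u)\<close>. Both vanish.\<close>
    then show "partial_deriv 2 A x = partial_deriv 1 B x" "partial_deriv 2 B x = partial_deriv 1 C x"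
      unfolding A_def B_def C_def
      by (simp_all only: d differentiable_add differentiable_diff differentiable_inner
          partial_deriv_add partial_deriv_diff partial_deriv_inner w(2)[OF that])
        (simp_all add: laplacian_def sum_2 inner_add_left inner_add_right inner_commute)
  qed
  obtain U where U: "C_k_on 3 U \<Omega>" "\<And>x. x \<in> \<Omega> \<Longrightarrow> hessian U x = hessian_field W u x"
    using symmetric_field_is_hessian[OF assms(1,3) C1 closed] unfolding field by blast
  have C2: "C_k_on 2 f \<Omega>" if "C_k_on 3 f \<Omega>" for f :: "real^2 \<Rightarrow> real"
    using C_k_on_SucD[of 2 f \<Omega>] that by simp
  have "hessian_potential \<Omega> W u V \<longleftrightarrow> (\<exists>a b. \<forall>x\<in>\<Omega>. V x = U x + a \<bullet> x + b)" for V
  proof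
    assume "hessian_potential \<Omega> W u V"
    then show "\<exists>a b. \<forall>x\<in>\<Omega>. V x = U x + a \<bullet> x + b"
      using U by (intro equal_hessians_imp_affine_difference[OF assms(1,2)] C2)
        (auto simp: hessian_potential_def)
  next
    assume "\<exists>a b. \<forall>x\<in>\<Omega>. V x = U x + a \<bullet> x + b"
    then obtain a b where V: "\<And>x. x \<in> \<Omega> \<Longrightarrow> U x + (a \<bullet> x + b) = V x"
      by (metis add.assoc)
    have "C_k_on 3 V \<Omega>"
      by (rule C_k_on_cong[OF assms(1) C_k_on_add[OF assms(1) U(1) C_k_on_affine] V])
    moreover have "hessian V x = hessian_field W u x" if "x \<in> \<Omega>" for x
    proof -
      \<comment> \<open>The first derivatives must agree on all of the open set, not only at
        \<open>x\<close>, before a second derivative can be taken.\<close>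
      have "partial_deriv i (\<lambda>x. U x + (a \<bullet> x + b)) y = partial_deriv i V y" if "y \<in> \<Omega>" for i y
        using V by (rule partial_deriv_cong[OF assms(1) that])
      then have "hessian (\<lambda>x. U x + (a \<bullet> x + b)) x = hessian V x"
        unfolding hessian_def
        by (auto simp: vec_eq_iff intro!: partial_deriv_cong[OF assms(1) that])
      then show ?thesis
        using hessian_add_affine[OF assms(1) C2[OF U(1)] that] U(2)[OF that] by simp
    qed
    ultimately show "hessian_potential \<Omega> W u V"
      by (simp add: hessian_potential_def)
  qed
  moreover have "laplacian V x = 4 * W (u x)" if "hessian_potential \<Omega> W u V" "x \<in> \<Omega>" for V x
  proof -
    have "laplacian V x = hessian V x $ 1 $ 1 + hessian V x $ 2 $ 2"
      by (simp add: laplacian_def hessian_def sum_2)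
    also have "\<dots> = 4 * W (u x)"
      using that by (simp add: hessian_potential_def field A_def C_def w_def)
    finally show ?thesis .
  qed
  moreover have "hessian_potential \<Omega> W u U"
    using U by (simp add: hessian_potential_def)
  ultimately show ?thesis
    by blast
qed

end
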